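(* Let $t\in\mathbb{N}$ and let $a_j,b_j\in\mathbb{N}_0$ and integers $c_j\ge3$ for all $j\ge1$. (i) If $r\ge1$ and $\mathbf{s}=(\{2\}^{b_1},c_1,\{2\}^{a_1},1,\dots,\{2\}^{b_r},c_r,\{2\}^{a_r},1,\{2\}^t)$, then \[\zeta^\star(\mathbf{s})=-\sum_{\mathbf{p}\in\Pi(\overline{2b_1+2},\{1\}^{c_1-3},\overline{2a_1+2},\,\dots,\,\overline{2b_r+2},\{1\}^{c_r-3},\overline{2a_r+2},\overline{2t})}2^{\ell(\mathbf{p})}\zeta(\mathbf{p}).\] (ii) If $r\ge0$, $a_0\in\mathbb{N}$ and $\mathbf{s}=(\{2\}^{a_0},1,\{2\}^{b_1},c_1,\{2\}^{a_1},1,\dots,\{2\}^{b_r},c_r,\{2\}^{a_r},1,\{2\}^t)$, then \[\zeta^\star(\mathbf{s})=-\sum_{\mathbf{p}\in\Pi(2a_0+1,\overline{2b_1+2},\{1\}^{c_1-3},\overline{2a_1+2},\,\dots,\,\overline{2b_r+2},\{1\}^{c_r-3},\overline{2a_r+2},\overline{2t})}2^{\ell(\mathbf{p})}\zeta(\mathbf{p}).\]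
   Context: $\mathbb{N}=\{1,2,\dots\}$, $\mathbb{N}_0=\mathbb{N}\cup\{0\}$; for a positive integer $m$, $\overline{m}$ denotes $-m$. $\{x\}^a$ denotes $a$ consecutive copies of $x$. For $\mathbf{s}=(s_1,\dots,s_\ell)$ with nonzero integer entries, $H_n(\mathbf{s})=\sum_{n\ge k_1>\cdots>k_\ell\ge1}\prod_{i=1}^\ell \frac{\operatorname{sgn}(s_i)^{k_i}}{k_i^{|s_i|}}$, $H^\star_n(\mathbf{s})$ is the same with $\ge$ in place of $>$, and when $s_1\ne1$, $\zeta(\mathbf{s})=\lim_{n\to\infty}H_n(\mathbf{s})$, $\zeta^\star(\mathbf{s})=\lim_{n\to\infty}H^\star_n(\mathbf{s})$. For nonzero integers $a,b$, $a\oplus b=\operatorname{sgn}(a)b+\operatorname{sgn}(b)a$. For a sequence $(s_1,\dots,s_m)$ of nonzero integers, $\Pi(s_1,\dots,s_m)$ is the set of the $2^{m-1}$ indices $s_1\circ\cdots\circ s_m$ where each $\circ$ is independently "," or $\oplus$ (entries joined by $\oplus$ merge into one component); $\ell(\mathbf{p})$ is the number of components. *)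

theory Defs
  imports "HOL-Analysis.Analysis"
begin

text \<open>
  An index is a list of (nonzero) integers.  A negative entry \<open>- m\<close> is the barred entry of the
  literature.  The first entry of an index belongs to the largest summation variable.
\<close>

definition mhs_term :: "int list \<Rightarrow> nat list \<Rightarrow> real" where
  "mhs_term s k =
     (\<Prod>i<length s. real_of_int (sgn (s ! i)) ^ (k ! i) / real (k ! i) ^ nat \<bar>s ! i\<bar>)"

definition mhs :: "nat \<Rightarrow> int list \<Rightarrow> real" where
  "mhs n s =
     (\<Sum>k | length k = length s \<and> set k \<subseteq> {1..n} \<and> sorted_wrt (>) k. mhs_term s k)"

definition mhs_star :: "nat \<Rightarrow> int list \<Rightarrow> real" where
  "mhs_star n s =
     (\<Sum>k | length k = length s \<and> set k \<subseteq> {1..n} \<and> sorted_wrt (\<ge>) k. mhs_term s k)"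

definition mzv :: "int list \<Rightarrow> real" where
  "mzv s = lim (\<lambda>n. mhs n s)"

definition mzv_star :: "int list \<Rightarrow> real" where
  "mzv_star s = lim (\<lambda>n. mhs_star n s)"

definition oplus :: "int \<Rightarrow> int \<Rightarrow> int"  (infixl "\<oplus>" 65) where
  "a \<oplus> b = sgn a * b + sgn b * a"

text \<open>
  All ways of replacing each separator by a comma or by \<open>\<oplus>\<close>, decided from left to right.  This is
  independent of bracketing because \<open>\<oplus>\<close> is associative on nonzero integers, and the
  \<open>2 ^ (m - 1)\<close> choices give pairwise distinct indices (see the lemmas below), so a
  sum over the set counts each choice once.
\<close>

fun Pi_indices :: "int list \<Rightarrow> int list set" where
  "Pi_indices [] = {[]}"
| "Pi_indices [a] = {[a]}"
| "Pi_indices (a # b # s) = (\<lambda>p. a # p) ` Pi_indices (b # s) \<union> Pi_indices ((a \<oplus> b) # s)"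

lemma oplus_conv: "a \<oplus> b = sgn a * sgn b * (\<bar>a\<bar> + \<bar>b\<bar>)"
  by (cases a "0::int" rule: linorder_cases; cases b "0::int" rule: linorder_cases)
     (simp_all add: oplus_def)

lemma abs_oplus: "a \<noteq> 0 \<Longrightarrow> b \<noteq> 0 \<Longrightarrow> \<bar>a \<oplus> b\<bar> = \<bar>a\<bar> + \<bar>b\<bar>"
  by (simp add: oplus_conv abs_mult)

lemma oplus_assoc:
  assumes "a \<noteq> 0" "b \<noteq> 0" "c \<noteq> 0"
  shows "(a \<oplus> b) \<oplus> c = a \<oplus> (b \<oplus> c)"
  using assms
  by (cases a "0::int" rule: linorder_cases; cases b "0::int" rule: linorder_cases;
      cases c "0::int" rule: linorder_cases) (simp_all add: oplus_def)

lemma finite_Pi_indices: "finite (Pi_indices s)"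
  by (induction s rule: Pi_indices.induct) auto

lemma Pi_indices_hd:
  "0 \<notin> set s \<Longrightarrow> s \<noteq> [] \<Longrightarrow> p \<in> Pi_indices s \<Longrightarrow> p \<noteq> [] \<and> \<bar>hd s\<bar> \<le> \<bar>hd p\<bar>"
proof (induction s arbitrary: p rule: Pi_indices.induct)
  case (3 a b s)
  have ab: "\<bar>a \<oplus> b\<bar> = \<bar>a\<bar> + \<bar>b\<bar>" "a \<oplus> b \<noteq> 0"
    using "3.prems"(1) abs_oplus[of a b] by auto
  show ?case
    using "3.prems" "3.IH"(2)[of p] ab by auto
qed auto

lemma card_Pi_indices: "0 \<notin> set s \<Longrightarrow> s \<noteq> [] \<Longrightarrow> card (Pi_indices s) = 2 ^ (length s - 1)"
proof (induction s rule: Pi_indices.induct)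
  case (3 a b s)
  have nz: "a \<noteq> 0" "b \<noteq> 0" using "3.prems" by auto
  have ab: "\<bar>a \<oplus> b\<bar> = \<bar>a\<bar> + \<bar>b\<bar>" "a \<oplus> b \<noteq> 0"
    using nz abs_oplus[of a b] by auto
  have "(\<lambda>p. a # p) ` Pi_indices (b # s) \<inter> Pi_indices ((a \<oplus> b) # s) = {}"
  proof -
    have "\<bar>hd p\<bar> > \<bar>a\<bar>" if "p \<in> Pi_indices ((a \<oplus> b) # s)" for p
      using Pi_indices_hd[of "(a \<oplus> b) # s" p] that "3.prems" ab nz by auto
    then show ?thesis by fastforce
  qed
  then have "card (Pi_indices (a # b # s)) =
      card (Pi_indices (b # s)) + card (Pi_indices ((a \<oplus> b) # s))"
    by (simp add: card_Un_disjoint finite_Pi_indices card_image inj_on_def)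
  also have "\<dots> = 2 ^ length s + 2 ^ length s"
    using "3.IH" "3.prems" ab by auto
  finally show ?case by simp
qed auto

end

theory Submission
  imports Defs "HOL-Real_Asymp.Real_Asymp"
begin

text \<open>
  The identity has a finite form: with \<open>C n k = binom n k / binom (n + k) k\<close>, the sum \<open>H\<^sup>\<star>\<^sub>n(s)\<close> equals
  minus the right-hand side truncated at \<open>n\<close>, with the extra weight \<open>C n k\<close> on the largest summation
  variable \<open>k\<close>. It is built up by prepending entries to \<open>s\<close>, starting from \<open>s = (2)\<close>, \<open>p = (-2)\<close>.
  Since \<open>C n k - C (n - 1) k = C n k * k\<^sup>2 / n\<^sup>2\<close>, prepending 2 to \<open>s\<close> adds 2 to the absolute value of the
  first entry of \<open>p\<close>. Multiplying and dividing a \<open>C\<close>-weighted sum by \<open>n\<close> can be expressed, by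
  telescoping in \<open>k\<close>, through the partial sums of the summand; this shows that prepending 1 to \<open>s\<close>
  prepends 1 to \<open>p\<close>, and prepending \<open>c \<ge> 3\<close> turns \<open>p = (m, \<dots>)\<close>, \<open>m > 0\<close>, into
  \<open>(-2, {1}\<^bsup>c-3\<^esup>, -(m + 1), \<dots>)\<close>. Finally \<open>C n k \<longlonglongrightarrow> 1\<close> as \<open>n\<close> grows, and dominated convergence applies
  because the first entry of every index involved has absolute value at least 2.
\<close>

section \<open>Summands, weights and the finite identity\<close>

definition mhs_factor :: "int \<Rightarrow> nat \<Rightarrow> real" where
  "mhs_factor a k = real_of_int (sgn a) ^ k / real k ^ nat \<bar>a\<bar>"

text \<open>The weight \<open>C n k\<close> in product form: its recursion in \<open>k\<close> is
  immediate, and for \<open>k > n\<close> the factor at \<open>i = n\<close> makes it 0.\<close>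

definition binom_ratio :: "nat \<Rightarrow> nat \<Rightarrow> real" where
  "binom_ratio n k = (\<Prod>i<k. (real n - real i) / (real n + 1 + real i))"

definition binom_sum :: "nat \<Rightarrow> (nat \<Rightarrow> real) \<Rightarrow> real" where
  "binom_sum n f = (\<Sum>k=1..n. binom_ratio n k * f k)"

text \<open>
  \<open>dbl_term p\<close> is the part of \<open>\<Sum>\<^sub>q 2 ^ length q * H(q)\<close>, \<open>q\<close> ranging over \<open>Pi_indices p\<close>, in which
  the largest summation variable is \<open>k\<close>: summing over \<open>k\<^sub>1 \<ge> k\<^sub>2 \<ge> \<dots>\<close> with weight 2 per distinct value
  merges the entries that share a value.
\<close>

definition dbl_sum :: "(nat \<Rightarrow> real) \<Rightarrow> nat \<Rightarrow> real" where
  "dbl_sum f k = f k + 2 * (\<Sum>j=1..<k. f j)"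

fun dbl_term :: "int list \<Rightarrow> nat \<Rightarrow> real" where
  "dbl_term [] k = 0"
| "dbl_term [a] k = 2 * mhs_factor a k"
| "dbl_term (a # b # s) k = mhs_factor a k * dbl_sum (dbl_term (b # s)) k"

fun mhs_top :: "int list \<Rightarrow> nat \<Rightarrow> real" where
  "mhs_top [] k = 0"
| "mhs_top (a # s) k = mhs_factor a k * mhs (k - 1) s"

text \<open>The finite identity is required for every \<open>n\<close>, so that increments in
  \<open>n\<close> can be compared.\<close>

definition dual_index :: "int list \<Rightarrow> int list \<Rightarrow> bool" where
  "dual_index s p \<longleftrightarrow> (\<forall>n. mhs_star n s = - binom_sum n (dbl_term p))"

text \<open>Merging entries means equating their summation variables: signs multiply and exponents
  add.\<close>

lemma mhs_factor_oplus:
  "a \<noteq> 0 \<Longrightarrow> b \<noteq> 0 \<Longrightarrow> mhs_factor (a \<oplus> b) k = mhs_factor a k * mhs_factor b k"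
  by (simp add: mhs_factor_def abs_oplus nat_add_distrib power_add)
     (simp add: oplus_conv sgn_mult power_mult_distrib)

lemma abs_mhs_factor_le: "k \<ge> 1 \<Longrightarrow> \<bar>mhs_factor a k\<bar> \<le> 1 / real k"
proof (cases "a = 0")
  case False
  assume k: "k \<ge> 1"
  have "\<bar>mhs_factor a k\<bar> = 1 / real k ^ nat \<bar>a\<bar>"
    using False by (simp add: mhs_factor_def abs_mult power_abs sgn_if)
  also have "\<dots> \<le> 1 / real k ^ 1"
    using k False by (intro divide_left_mono power_increasing) auto
  finally show ?thesis by simp
qed (simp add: mhs_factor_def power_0_left)

lemma abs_mhs_factor_le2: "k \<ge> 1 \<Longrightarrow> \<bar>a\<bar> \<ge> 2 \<Longrightarrow> \<bar>mhs_factor a k\<bar> \<le> 1 / real k ^ 2"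
proof -
  assume k: "k \<ge> 1" and a: "\<bar>a\<bar> \<ge> 2"
  have "\<bar>mhs_factor a k\<bar> = 1 / real k ^ nat \<bar>a\<bar>"
    using a by (auto simp add: mhs_factor_def abs_mult power_abs sgn_if)
  also have "\<dots> \<le> 1 / real k ^ 2"
    using k a by (intro divide_left_mono power_increasing) auto
  finally show ?thesis .
qed

subsection \<open>Recursion for multiple harmonic sums\<close>

lemma finite_lists_of_length:
  "finite {k. length k = l \<and> set k \<subseteq> {1..n::nat} \<and> P k}"
  by (rule finite_subset[OF _ finite_lists_length_eq[of "{1..n}" l]]) auto

lemma mhs_term_Cons: "mhs_term (a # s) (k # ks) = mhs_factor a k * mhs_term s ks"
  by (simp add: mhs_term_def mhs_factor_def prod.lessThan_Suc_shift del: prod.lessThan_Suc)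

text \<open>Peels off the largest variable \<open>k\<close>. \<open>B k\<close> holds the admissible
  tails, bounded by \<open>k - 1\<close> for strict and by \<open>k\<close> for weak
  ordering.\<close>

lemma sum_mhs_term_Cons:
  assumes S: "{k. length k = length (a # s) \<and> set k \<subseteq> {1..n::nat} \<and> P k}
      = (\<lambda>(k, ks). k # ks) ` (SIGMA k:{1..n}. B k)"
    and fin: "\<And>k. finite (B k)"
  shows "(\<Sum>k | length k = length (a # s) \<and> set k \<subseteq> {1..n} \<and> P k. mhs_term (a # s) k)
      = (\<Sum>k=1..n. mhs_factor a k * (\<Sum>ks\<in>B k. mhs_term s ks))"
proof -
  have "(\<Sum>k | length k = length (a # s) \<and> set k \<subseteq> {1..n} \<and> P k. mhs_term (a # s) k)
      = (\<Sum>(k, ks)\<in>(SIGMA k:{1..n}. B k). mhs_factor a k * mhs_term s ks)"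
    unfolding S by (subst sum.reindex) (auto simp: inj_on_def mhs_term_Cons intro!: sum.cong)
  also have "\<dots> = (\<Sum>k=1..n. \<Sum>ks\<in>B k. mhs_factor a k * mhs_term s ks)"
    using fin by (subst sum.Sigma) auto
  finally show ?thesis by (simp add: sum_distrib_left)
qed

lemma mhs_Cons: "mhs n (a # s) = (\<Sum>k=1..n. mhs_factor a k * mhs (k - 1) s)"
  unfolding mhs_def
proof (rule sum_mhs_term_Cons)
  show "{k. length k = length (a # s) \<and> set k \<subseteq> {1..n} \<and> sorted_wrt (>) k}
      = (\<lambda>(k, ks). k # ks) ` (SIGMA k:{1..n}.
          {ks. length ks = length s \<and> set ks \<subseteq> {1..k-1} \<and> sorted_wrt (>) ks})" (is "?L = ?R")
  proof (intro set_eqI iffI)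
    fix x assume "x \<in> ?L"
    then show "x \<in> ?R" by (cases x) (fastforce simp: image_iff)+
  next
    fix x assume "x \<in> ?R"
    then show "x \<in> ?L" by fastforce
  qed
qed (rule finite_lists_of_length)

lemma mhs_star_Cons: "mhs_star n (a # s) = (\<Sum>k=1..n. mhs_factor a k * mhs_star k s)"
  unfolding mhs_star_def
proof (rule sum_mhs_term_Cons)
  show "{k. length k = length (a # s) \<and> set k \<subseteq> {1..n} \<and> sorted_wrt (\<ge>) k}
      = (\<lambda>(k, ks). k # ks) ` (SIGMA k:{1..n}.
          {ks. length ks = length s \<and> set ks \<subseteq> {1..k} \<and> sorted_wrt (\<ge>) ks})" (is "?L = ?R")
  proof (intro set_eqI iffI)
    fix x assume "x \<in> ?L"
    then show "x \<in> ?R" by (cases x) (fastforce simp: image_iff)+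
  next
    fix x assume "x \<in> ?R"
    then show "x \<in> ?L" by fastforce
  qed
qed (rule finite_lists_of_length)

lemma mhs_Nil: "mhs n [] = 1"
proof -
  have "{k::nat list. length k = length ([]::int list) \<and> set k \<subseteq> {1..n} \<and> sorted_wrt (>) k} = {[]}"
    by auto
  then show ?thesis unfolding mhs_def by (simp add: mhs_term_def)
qed

lemma mhs_star_Nil: "mhs_star n [] = 1"
proof -
  have "{k::nat list. length k = length ([]::int list) \<and> set k \<subseteq> {1..n} \<and> sorted_wrt (\<ge>) k} = {[]}"
    by auto
  then show ?thesis unfolding mhs_star_def by (simp add: mhs_term_def)
qed

lemma mhs_eq_sum_top: "s \<noteq> [] \<Longrightarrow> mhs n s = (\<Sum>k=1..n. mhs_top s k)"
  by (cases s) (simp_all add: mhs_Cons)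

subsection \<open>Sums weighted by binomial ratios\<close>

lemma binom_ratio_0 [simp]: "binom_ratio n 0 = 1"
  by (simp add: binom_ratio_def)

lemma binom_ratio_Suc:
  "(real n + real k + 1) * binom_ratio n (Suc k) = (real n - real k) * binom_ratio n k"
  by (simp add: binom_ratio_def field_simps)

lemma binom_ratio_eq_0: "n < k \<Longrightarrow> binom_ratio n k = 0"
  unfolding binom_ratio_def by (rule prod_zero) auto

lemma binom_ratio_bounds: "0 \<le> binom_ratio n k" "binom_ratio n k \<le> 1"
proof -
  have "0 \<le> binom_ratio n k \<and> binom_ratio n k \<le> 1"
  proof (cases "n < k")
    case False
    then show ?thesis unfolding binom_ratio_def
      by (intro conjI prod_nonneg prod_le_1) auto
  qed (simp add: binom_ratio_eq_0)
  then show "0 \<le> binom_ratio n k" "binom_ratio n k \<le> 1" by auto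
qed

lemma binom_ratio_tendsto: "(\<lambda>n. binom_ratio n k) \<longlonglongrightarrow> 1"
proof -
  have "(\<lambda>n. (real n - real i) / (real n + 1 + real i)) \<longlonglongrightarrow> 1" for i
    by real_asymp
  from tendsto_prod[of "{..<k}", OF this] show ?thesis
    by (simp add: binom_ratio_def)
qed

lemma binom_ratio_Suc_left:
  "(real n + 1)\<^sup>2 * binom_ratio n k
    = ((real n + 1)\<^sup>2 - (real k)\<^sup>2) * binom_ratio (Suc n) k"
proof (induction k)
  case (Suc k)
  let ?m = "real n + 1" and ?k = "real k"
  have 1: "(?m + ?k) * binom_ratio n (Suc k) = (?m - 1 - ?k) * binom_ratio n k"
    using binom_ratio_Suc[of n k] by (simp add: algebra_simps)
  have 2: "(?m + ?k + 1) * binom_ratio (Suc n) (Suc k) = (?m - ?k) * binom_ratio (Suc n) k"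
    using binom_ratio_Suc[of "Suc n" k] by (simp add: algebra_simps)
  \<comment> \<open>The positive factor \<open>?m + ?k\<close> makes both recursions in
    \<open>k\<close> applicable and is cancelled at the end.\<close>
  have "(?m + ?k) * (?m\<^sup>2 * binom_ratio n (Suc k))
      = (?m - 1 - ?k) * (?m\<^sup>2 * binom_ratio n k)"
    using 1 by algebra
  also have "\<dots> = (?m - 1 - ?k) * (?m + ?k) * ((?m - ?k) * binom_ratio (Suc n) k)"
    unfolding Suc.IH by algebra
  also have "\<dots> = (?m + ?k) * ((?m\<^sup>2 - (?k + 1)\<^sup>2) * binom_ratio (Suc n) (Suc k))"
    unfolding 2[symmetric] by algebra
  finally show ?case by (simp add: add.commute add_eq_0_iff_both_eq_0)
qed simp

lemma binom_sum_diff: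
  "binom_sum (Suc n) f - binom_sum n f
    = binom_sum (Suc n) (\<lambda>k. (real k)\<^sup>2 * f k) / (real (Suc n))\<^sup>2"
proof -
  \<comment> \<open>The extra term vanishes because
    \<open>binom_ratio n (Suc n) = 0\<close>.\<close>
  have "binom_sum n f = (\<Sum>k=1..Suc n. binom_ratio n k * f k)"
    by (simp add: binom_sum_def binom_ratio_eq_0)
  also have "\<dots> = (\<Sum>k=1..Suc n. binom_ratio (Suc n) k * f k
      - binom_ratio (Suc n) k * ((real k)\<^sup>2 * f k) / (real (Suc n))\<^sup>2)"
  proof (intro sum.cong refl)
    fix k
    have "binom_ratio n k
        = binom_ratio (Suc n) k - (real k)\<^sup>2 * binom_ratio (Suc n) k / (real n + 1)\<^sup>2"
      using binom_ratio_Suc_left[of n k]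
      by (simp add: field_simps add_eq_0_iff_both_eq_0)
    then show "binom_ratio n k * f k = binom_ratio (Suc n) k * f k
      - binom_ratio (Suc n) k * ((real k)\<^sup>2 * f k) / (real (Suc n))\<^sup>2"
      by (simp add: left_diff_distrib right_diff_distrib mult_ac add.commute)
  qed
  finally show ?thesis
    by (simp add: binom_sum_def sum_subtractf sum_divide_distrib del: sum.cl_ivl_Suc)
qed

text \<open>
  In the next three identities the partial sum up to \<open>N\<close> carries a boundary term with the factor
  \<open>n - N\<close>, which is why they close at \<open>N = n\<close>.
\<close>

lemma binom_sum_alternating:
  assumes "n \<ge> 1"
  shows "binom_sum n (\<lambda>k. 2 * (-1) ^ k) = -1"
proof -
  have "real n * (\<Sum>k=1..N. binom_ratio n k * (2 * (-1) ^ k))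
      = (-1) ^ N * ((real n - real N) * binom_ratio n N) - real n" for N
  proof (induction N)
    case (Suc N)
    define S where "S = (\<Sum>k=1..N. binom_ratio n k * (2 * (-1) ^ k))"
    define e where "e = (-1 :: real) ^ N"
    have "real n * (S - 2 * binom_ratio n (Suc N) * e)
        = - e * ((real n - (real N + 1)) * binom_ratio n (Suc N)) - real n"
      using Suc binom_ratio_Suc[of n N] unfolding S_def[symmetric] e_def[symmetric] by algebra
    then show ?case by (simp add: S_def e_def algebra_simps)
  qed simp
  from this[of n] have "real n * binom_sum n (\<lambda>k. 2 * (-1) ^ k) = real n * (-1)"
    by (simp add: binom_sum_def)
  then show ?thesis using assms mult_left_cancel[of "real n"] by fastforce
qed

lemma binom_sum_times: "real n * binom_sum n f = binom_sum n (\<lambda>k. real k * dbl_sum f k)"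
proof -
  have "(\<Sum>k=1..N. binom_ratio n k * (real k * dbl_sum f k))
      = real n * (\<Sum>k=1..N. binom_ratio n k * f k)
        - ((real n - real N) * binom_ratio n N) * (\<Sum>k=1..N. f k)" for N
  proof (induction N)
    case (Suc N)
    have "dbl_sum f (Suc N) = f (Suc N) + 2 * (\<Sum>k=1..N. f k)"
      by (simp add: dbl_sum_def atLeastLessThanSuc_atLeastAtMost)
    then show ?case
      using Suc.IH binom_ratio_Suc[of n N] by simp algebra
  qed simp
  from this[of n] show ?thesis by (simp add: binom_sum_def)
qed

lemma binom_sum_divide:
  assumes "n \<ge> 1"
  shows "binom_sum n (\<lambda>k. (-1) ^ k * real k * f k) / real n
    = binom_sum n (\<lambda>k. (-1) ^ k * dbl_sum f k)"
proof -
  have "real n * (\<Sum>k=1..N. binom_ratio n k * ((-1) ^ k * dbl_sum f k))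
      = (\<Sum>k=1..N. binom_ratio n k * ((-1) ^ k * real k * f k))
        + (-1) ^ N * ((real n - real N) * binom_ratio n N) * (\<Sum>k=1..N. f k)" for N
  proof (induction N)
    case (Suc N)
    define S where "S = (\<Sum>k=1..N. binom_ratio n k * ((-1) ^ k * dbl_sum f k))"
    define T where "T = (\<Sum>k=1..N. binom_ratio n k * ((-1) ^ k * real k * f k))"
    define F where "F = (\<Sum>k=1..N. f k)"
    define e where "e = (-1 :: real) ^ N"
    have D: "dbl_sum f (Suc N) = f (Suc N) + 2 * F"
      by (simp add: dbl_sum_def F_def atLeastLessThanSuc_atLeastAtMost)
    have "real n * (S + binom_ratio n (Suc N) * ((- e) * dbl_sum f (Suc N)))
        = T + binom_ratio n (Suc N) * ((- e) * (real N + 1) * f (Suc N))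
          + (- e) * ((real n - (real N + 1)) * binom_ratio n (Suc N)) * (F + f (Suc N))"
      using Suc.IH D binom_ratio_Suc[of n N]
      unfolding S_def[symmetric] T_def[symmetric] F_def[symmetric] e_def[symmetric] by algebra
    then show ?case by (simp add: S_def T_def F_def e_def add.commute)
  qed simp
  from this[of n] show ?thesis using assms by (simp add: binom_sum_def field_simps)
qed

lemma binom_sum_cong:
  "(\<And>k. k \<ge> 1 \<Longrightarrow> f k = g k) \<Longrightarrow> binom_sum n f = binom_sum n g"
  by (auto simp: binom_sum_def intro!: sum.cong)

subsection \<open>Prepending entries\<close>

lemma dbl_term_Cons:
  "s \<noteq> [] \<Longrightarrow> dbl_term (a # s) k = mhs_factor a k * dbl_sum (dbl_term s) k"
  by (cases s) auto

lemma dbl_term_oplus: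
  assumes "a \<noteq> 0" "b \<noteq> 0"
  shows "dbl_term ((a \<oplus> b) # s) k = mhs_factor a k * dbl_term (b # s) k"
  by (cases s) (simp_all add: mhs_factor_oplus assms)

text \<open>Both sides of the finite identity vanish at \<open>n = 0\<close>, so comparing
  increments suffices; \<open>binom_sum_diff\<close> supplies the one on the right.\<close>

lemma dual_indexI:
  assumes "\<And>n. mhs_star (Suc n) s / real (Suc n) ^ m
    = - binom_sum (Suc n) (\<lambda>k. (real k)\<^sup>2 * dbl_term p k) / (real (Suc n))\<^sup>2"
    and "c = int m" "m \<ge> 1"
  shows "dual_index (c # s) p"
proof -
  have "mhs_star n (c # s) = - binom_sum n (dbl_term p)" for n
  proof (induction n)
    case (Suc n)
    have "mhs_star (Suc n) (c # s) = mhs_star n (c # s) + mhs_star (Suc n) s / real (Suc n) ^ m"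
      using assms(2,3) by (simp add: mhs_star_Cons mhs_factor_def sgn_if)
    then show ?case
      using binom_sum_diff[of n "dbl_term p"] Suc assms(1)[of n] by simp
  qed (simp add: mhs_star_Cons binom_sum_def)
  then show ?thesis by (simp add: dual_index_def)
qed

lemma dual_index_2: "dual_index [2] [-2]"
proof (rule dual_indexI[where m = 2])
  fix n
  have "binom_sum (Suc n) (\<lambda>k. (real k)\<^sup>2 * dbl_term [-2] k)
      = binom_sum (Suc n) (\<lambda>k. 2 * (-1) ^ k)"
    by (rule binom_sum_cong) (simp add: mhs_factor_def)
  then show "mhs_star (Suc n) [] / real (Suc n) ^ 2
    = - binom_sum (Suc n) (\<lambda>k. (real k)\<^sup>2 * dbl_term [-2] k) / (real (Suc n))\<^sup>2"
    by (simp add: binom_sum_alternating mhs_star_Nil)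
qed auto

text \<open>Merging 2 into \<open>a\<close> contributes \<open>1 / k^2\<close>, which cancels the
  \<open>k^2\<close> from the increment.\<close>

lemma dual_index_Cons_2:
  assumes "dual_index s (a # p)" "a \<noteq> 0"
  shows "dual_index (2 # s) ((2 \<oplus> a) # p)"
proof (rule dual_indexI[where m = 2])
  fix n
  have "binom_sum (Suc n) (\<lambda>k. (real k)\<^sup>2 * dbl_term ((2 \<oplus> a) # p) k)
      = binom_sum (Suc n) (dbl_term (a # p))"
    using assms(2) by (intro binom_sum_cong) (simp add: dbl_term_oplus mhs_factor_def)
  then show "mhs_star (Suc n) s / real (Suc n) ^ 2
    = - binom_sum (Suc n) (\<lambda>k. (real k)\<^sup>2 * dbl_term ((2 \<oplus> a) # p) k) / (real (Suc n))\<^sup>2"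
    using assms(1) by (simp add: dual_index_def)
qed auto

lemma dual_index_replicate_2:
  assumes "dual_index s (a # p)" "a \<noteq> 0"
  shows "dual_index (replicate m 2 @ s) ((a + sgn a * (2 * int m)) # p)"
proof (induction m)
  case (Suc m)
  have "a + sgn a * (2 * int m) \<noteq> 0"
    using assms(2) by (auto simp: sgn_if)
  from dual_index_Cons_2[OF Suc this]
  have "dual_index (2 # replicate m 2 @ s) ((2 \<oplus> (a + sgn a * (2 * int m))) # p)" .
  moreover have "2 \<oplus> (a + sgn a * (2 * int m)) = a + sgn a * (2 * int (Suc m))"
    using assms(2) by (auto simp: sgn_if oplus_def)
  ultimately show ?case by simp
qed (simp add: assms)

text \<open>After the new entry absorbs one \<open>k\<close> of \<open>k^2\<close>,
  \<open>binom_sum_times\<close> trades the other for \<open>n\<close>, and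
  \<open>n / n^2 = 1 / n\<close>.\<close>

lemma dual_index_Cons_1:
  assumes "dual_index s p" "p \<noteq> []"
  shows "dual_index (1 # s) (1 # p)"
proof (rule dual_indexI[where m = 1])
  fix n
  have "binom_sum (Suc n) (\<lambda>k. (real k)\<^sup>2 * dbl_term (1 # p) k)
      = binom_sum (Suc n) (\<lambda>k. real k * dbl_sum (dbl_term p) k)"
    using assms(2)
    by (intro binom_sum_cong) (simp add: dbl_term_Cons mhs_factor_def power2_eq_square)
  also have "\<dots> = real (Suc n) * binom_sum (Suc n) (dbl_term p)"
    by (rule binom_sum_times[symmetric])
  finally show "mhs_star (Suc n) s / real (Suc n) ^ 1
    = - binom_sum (Suc n) (\<lambda>k. (real k)\<^sup>2 * dbl_term (1 # p) k) / (real (Suc n))\<^sup>2"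
    using assms(1) by (simp add: dual_index_def power2_eq_square del: of_nat_Suc)
qed auto

text \<open>The first division by \<open>Suc n\<close> creates \<open>-2\<close> and turns
  \<open>m\<close> into \<open>- (m + 1)\<close>; each later one inserts a 1 right after
  \<open>-2\<close>.\<close>

lemma binom_sum_dbl_term_divide:
  assumes "m > 0"
  shows "binom_sum (Suc n) (dbl_term (m # p)) / real (Suc n) ^ Suc d
    = binom_sum (Suc n)
        (\<lambda>k. (real k)\<^sup>2 * dbl_term (-2 # replicate d 1 @ - (m + 1) # p) k)"
proof (induction d)
  case 0
  \<comment> \<open>Splitting off \<open>-1\<close> yields \<open>(-1)^k / k\<close>, which
    compensates the factor \<open>(-1)^k * k\<close> that \<open>binom_sum_divide\<close>
    expects.\<close>
  have m: "- (m + 1) = -1 \<oplus> m" using assms by (simp add: oplus_def)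
  have "binom_sum (Suc n) (dbl_term (m # p))
      = binom_sum (Suc n) (\<lambda>k. (-1) ^ k * real k * dbl_term (- (m + 1) # p) k)"
    unfolding m using assms
    by (intro binom_sum_cong) (simp add: dbl_term_oplus mhs_factor_def flip: power_mult_distrib)
  also have "\<dots> / real (Suc n)
      = binom_sum (Suc n) (\<lambda>k. (-1) ^ k * dbl_sum (dbl_term (- (m + 1) # p)) k)"
    by (rule binom_sum_divide) simp
  also have "\<dots> = binom_sum (Suc n) (\<lambda>k. (real k)\<^sup>2 * dbl_term (-2 # - (m + 1) # p) k)"
    by (intro binom_sum_cong) (simp add: mhs_factor_def)
  finally show ?case by simp
next
  case (Suc d)
  define q where "q = replicate d 1 @ - (m + 1) # p"
  have q: "q \<noteq> []" by (simp add: q_def)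
  have "binom_sum (Suc n) (dbl_term (m # p)) / real (Suc n) ^ Suc (Suc d)
      = binom_sum (Suc n) (\<lambda>k. (real k)\<^sup>2 * dbl_term (-2 # q) k) / real (Suc n)"
    unfolding q_def Suc.IH[symmetric] by simp
  also have "binom_sum (Suc n) (\<lambda>k. (real k)\<^sup>2 * dbl_term (-2 # q) k)
      = binom_sum (Suc n) (\<lambda>k. (-1) ^ k * real k * dbl_term (1 # q) k)"
    using q by (intro binom_sum_cong) (simp add: dbl_term_Cons mhs_factor_def)
  also have "\<dots> / real (Suc n)
      = binom_sum (Suc n) (\<lambda>k. (-1) ^ k * dbl_sum (dbl_term (1 # q)) k)"
    by (rule binom_sum_divide) simp
  also have "\<dots> = binom_sum (Suc n) (\<lambda>k. (real k)\<^sup>2 * dbl_term (-2 # 1 # q) k)"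
    by (intro binom_sum_cong) (simp add: mhs_factor_def)
  finally show ?case by (simp add: q_def)
qed

lemma dual_index_Cons_ge_3:
  assumes "dual_index s (m # p)" "m > 0" "c \<ge> 3"
  shows "dual_index (c # s) (-2 # replicate (nat (c - 3)) 1 @ - (m + 1) # p)"
proof (rule dual_indexI[where m = "nat c"])
  fix n
  \<comment> \<open>Of the \<open>c\<close> divisions by \<open>Suc n\<close>, \<open>c - 2\<close>
    build the new entries and two match the increment on the right.\<close>
  have c: "nat c = Suc (nat (c - 3)) + 2" using assms(3) by simp
  show "mhs_star (Suc n) s / real (Suc n) ^ nat c
    = - binom_sum (Suc n) (\<lambda>k. (real k)\<^sup>2
          * dbl_term (-2 # replicate (nat (c - 3)) 1 @ - (m + 1) # p) k) / (real (Suc n))\<^sup>2"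
    unfolding c binom_sum_dbl_term_divide[OF assms(2), symmetric] power_add
    using assms(1) by (simp add: dual_index_def)
qed (use assms in auto)

text \<open>Read from the right: 1 opens a new entry, the \<open>a\<close> twos raise it to
  \<open>2a + 1\<close>, \<open>c\<close> turns it into \<open>-(2a + 2)\<close> preceded by
  \<open>-2\<close> and ones, and the \<open>b\<close> twos turn \<open>-2\<close> into
  \<open>-(2b + 2)\<close>.\<close>

lemma dual_index_block:
  assumes "dual_index s p" "p \<noteq> []" "c \<ge> 3"
  shows "dual_index (replicate b 2 @ [c] @ replicate a 2 @ [1] @ s)
    ([- (2 * int b + 2)] @ replicate (nat (c - 3)) 1 @ [- (2 * int a + 2)] @ p)"
proof -
  have "dual_index (replicate a 2 @ 1 # s) ((1 + 2 * int a) # p)"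
    using dual_index_replicate_2[OF dual_index_Cons_1[OF assms(1,2)], of a] by simp
  from dual_index_Cons_ge_3[OF this _ assms(3)]
  have "dual_index (c # replicate a 2 @ 1 # s)
      (-2 # replicate (nat (c - 3)) 1 @ - (2 * int a + 2) # p)"
    by (simp add: algebra_simps)
  from dual_index_replicate_2[OF this, of b] show ?thesis by (simp add: algebra_simps)
qed

lemma dual_index_blocks:
  assumes "t \<ge> 1" "\<And>j. j \<in> set js \<Longrightarrow> c j \<ge> 3"
  shows "dual_index
    (concat (map (\<lambda>j. replicate (b j) 2 @ [c j] @ replicate (a j) 2 @ [1]) js) @ replicate t 2)
    (concat (map (\<lambda>j. [- (2 * int (b j) + 2)] @ replicate (nat (c j - 3)) 1
        @ [- (2 * int (a j) + 2)]) js) @ [- (2 * int t)])"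
  using assms(2)
proof (induction js)
  case Nil
  \<comment> \<open>One of the \<open>t\<close> twos is the starting index \<open>[2]\<close>; the
    other \<open>u\<close> are prepended.\<close>
  obtain u where t: "t = Suc u" using assms(1) by (cases t) auto
  have "replicate t (2::int) = replicate u 2 @ [2]" by (simp add: t replicate_append_same)
  then show ?case
    using dual_index_replicate_2[OF dual_index_2, of u] by (simp add: t algebra_simps)
next
  case (Cons j js)
  show ?case
    using dual_index_block[OF Cons.IH, of "c j" "b j" "a j"] Cons.prems by simp
qed

subsection \<open>Expansion over merged indices\<close>

text \<open>Induction on the first separator. A comma makes the next variable strictly smaller and
  adds a component, giving twice the partial sum in \<open>dbl_sum\<close>; a merge gives its term
  at \<open>k\<close>.\<close>

lemma sum_Pi_indices_mhs_top:
  "0 \<notin> set s \<Longrightarrow> s \<noteq> [] \<Longrightarrow> k \<ge> 1 \<Longrightarrow>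
    (\<Sum>p\<in>Pi_indices s. 2 ^ length p * mhs_top p k) = dbl_term s k"
proof (induction s arbitrary: k rule: Pi_indices.induct)
  case (2 a)
  then show ?case by (simp add: mhs_Nil)
next
  case (3 a b s)
  have nz: "a \<noteq> 0" "b \<noteq> 0" "a \<oplus> b \<noteq> 0" "0 \<notin> set s"
    using "3.prems"(1) abs_oplus[of a b] by auto
  \<comment> \<open>A merge strictly enlarges the absolute value of the first entry.\<close>
  have disj: "(\<lambda>p. a # p) ` Pi_indices (b # s) \<inter> Pi_indices ((a \<oplus> b) # s) = {}"
  proof -
    have "\<bar>hd p\<bar> > \<bar>a\<bar>" if "p \<in> Pi_indices ((a \<oplus> b) # s)" for p
      using Pi_indices_hd[of "(a \<oplus> b) # s" p] that nz abs_oplus[of a b] by auto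
    then show ?thesis by fastforce
  qed
  have ne: "p \<noteq> []" if "p \<in> Pi_indices (b # s)" for p
    using Pi_indices_hd[of "b # s" p] that nz by auto
  have "(\<Sum>p\<in>(\<lambda>p. a # p) ` Pi_indices (b # s). 2 ^ length p * mhs_top p k)
      = (\<Sum>p\<in>Pi_indices (b # s). 2 * mhs_factor a k * (2 ^ length p * mhs (k - 1) p))"
    by (subst sum.reindex) (auto simp: mult_ac)
  also have "\<dots> = 2 * mhs_factor a k * (\<Sum>p\<in>Pi_indices (b # s). \<Sum>j=1..<k. 2 ^ length p * mhs_top p j)"
    unfolding sum_distrib_left
  proof (rule sum.cong[OF refl])
    fix p assume p: "p \<in> Pi_indices (b # s)"
    have "{1..k-1} = {1..<k}" using "3.prems"(3) by auto
    then show "2 * mhs_factor a k * (2 ^ length p * mhs (k - 1) p)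
        = (\<Sum>j=1..<k. 2 * mhs_factor a k * (2 ^ length p * mhs_top p j))"
      by (simp add: mhs_eq_sum_top[OF ne[OF p]] sum_distrib_left)
  qed
  also have "(\<Sum>p\<in>Pi_indices (b # s). \<Sum>j=1..<k. 2 ^ length p * mhs_top p j)
      = (\<Sum>j=1..<k. dbl_term (b # s) j)"
    using "3.IH"(1) nz by (subst sum.swap) (auto intro!: sum.cong)
  finally have 1: "(\<Sum>p\<in>(\<lambda>p. a # p) ` Pi_indices (b # s). 2 ^ length p * mhs_top p k)
      = 2 * mhs_factor a k * (\<Sum>j=1..<k. dbl_term (b # s) j)" .
  have 2: "(\<Sum>p\<in>Pi_indices ((a \<oplus> b) # s). 2 ^ length p * mhs_top p k)
      = mhs_factor a k * dbl_term (b # s) k"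
    using "3.IH"(2)[of k] "3.prems"(3) nz by (simp add: dbl_term_oplus)
  show ?case
    using 1 2 disj by (simp add: sum.union_disjoint finite_Pi_indices dbl_sum_def algebra_simps)
qed simp

lemma binom_sum_dbl_term:
  assumes "0 \<notin> set s" "s \<noteq> []"
  shows "binom_sum n (dbl_term s) = (\<Sum>p\<in>Pi_indices s. 2 ^ length p * binom_sum n (mhs_top p))"
proof -
  have "binom_sum n (dbl_term s)
      = (\<Sum>k=1..n. \<Sum>p\<in>Pi_indices s. 2 ^ length p * (binom_ratio n k * mhs_top p k))"
    unfolding binom_sum_def
    by (intro sum.cong refl)
       (simp add: sum_Pi_indices_mhs_top[OF assms, symmetric] sum_distrib_left mult_ac)
  also have "\<dots> = (\<Sum>p\<in>Pi_indices s. \<Sum>k=1..n. 2 ^ length p * (binom_ratio n k * mhs_top p k))"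
    by (rule sum.swap)
  finally show ?thesis by (simp add: binom_sum_def sum_distrib_left)
qed

subsection \<open>Passage to the limit\<close>

lemma harm_le_powr:
  assumes "e > 0" "k \<ge> 1"
  shows "harm k \<le> (1 + 1 / e) * real k powr e"
proof -
  have "harm k \<le> 1 + ln (real k)"
  proof -
    obtain m where m: "k = Suc m" using assms(2) by (cases k) auto
    \<comment> \<open>\<open>harm (Suc m) - ln (Suc m)\<close> decreases from its value 1 at
      \<open>m = 0\<close>.\<close>
    show ?thesis
      using decseqD[OF decseq_harm_diff_ln, of 0 m] by (simp add: m harm_expand)
  qed
  also have "ln (real k) \<le> real k powr e / e"
    using assms by (intro ln_powr_bound) auto
  also have "1 \<le> real k powr e"
    using assms by (simp add: ge_one_powr_ge_zero)
  finally show ?thesis by (simp add: algebra_simps)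
qed

text \<open>Dropping signs and ordering, with exponents lowered to 1, leaves a product of harmonic
  numbers.\<close>

lemma abs_mhs_le: "\<bar>mhs n s\<bar> \<le> harm n ^ length s"
proof (induction s arbitrary: n)
  case (Cons a s)
  have "\<bar>mhs n (a # s)\<bar> \<le> (\<Sum>k=1..n. \<bar>mhs_factor a k * mhs (k - 1) s\<bar>)"
    unfolding mhs_Cons by (rule sum_abs)
  also have "\<dots> \<le> (\<Sum>k=1..n. 1 / real k * harm n ^ length s)"
  proof (rule sum_mono)
    fix k assume k: "k \<in> {1..n}"
    have "harm (k - 1) \<le> (harm n :: real)"
      using k by (intro harm_mono) auto
    then have "\<bar>mhs (k - 1) s\<bar> \<le> harm n ^ length s"
      using Cons[of "k - 1"] by (meson harm_nonneg order_trans power_mono)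
    then show "\<bar>mhs_factor a k * mhs (k - 1) s\<bar> \<le> 1 / real k * harm n ^ length s"
      unfolding abs_mult using k by (intro mult_mono abs_mhs_factor_le) auto
  qed
  also have "\<dots> = harm n ^ length (a # s)"
    by (simp add: harm_def sum_distrib_right inverse_eq_divide)
  finally show ?case .
qed (simp add: mhs_Nil)

lemma mhs_top_dominated:
  assumes "p \<noteq> []" "\<bar>hd p\<bar> \<ge> 2"
  shows "\<exists>h. summable h \<and> (\<forall>k. \<bar>mhs_top p (Suc k)\<bar> \<le> h k)"
proof -
  obtain a s where p: "p = a # s" using assms(1) by (cases p) auto
  define l where "l = length s"
  \<comment> \<open>With this \<open>e\<close>, the \<open>l\<close> harmonic factors cost at most
    \<open>k powr (1/2)\<close>; the leading \<open>1 / k^2\<close> then leaves the summable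
    exponent \<open>-3/2\<close>.\<close>
  define e where "e = 1 / (2 * (real l + 1))"
  define C where "C = (1 + 1 / e) ^ l"
  have e: "e > 0" by (simp add: e_def)
  have le: "e * real l \<le> 1 / 2" by (simp add: e_def field_simps)
  have bound: "\<bar>mhs_top p k\<bar> \<le> C * real k powr (- 3 / 2)" if k: "k \<ge> 1" for k
  proof -
    have "harm (k - 1) \<le> (harm k :: real)" by (intro harm_mono) auto
    then have "harm (k - 1) \<le> (1 + 1 / e) * real k powr e"
      using harm_le_powr[OF e k] by linarith
    then have "(harm (k - 1) :: real) ^ l \<le> ((1 + 1 / e) * real k powr e) ^ l"
      by (intro power_mono) (auto simp: harm_nonneg)
    also have "\<dots> = C * real k powr (e * real l)"
      using k by (simp add: C_def power_mult_distrib powr_powr flip: powr_realpow)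
    also have "\<dots> \<le> C * real k powr (1 / 2)"
      using k e le by (intro mult_left_mono powr_mono) (auto simp: C_def)
    finally have "\<bar>mhs (k - 1) s\<bar> \<le> C * real k powr (1 / 2)"
      using abs_mhs_le[of "k - 1" s] unfolding l_def by linarith
    then have "\<bar>mhs_top p k\<bar> \<le> 1 / real k ^ 2 * (C * real k powr (1 / 2))"
      unfolding p mhs_top.simps abs_mult using k assms(2)
      by (intro mult_mono abs_mhs_factor_le2) (auto simp: p)
    also have "1 / real k ^ 2 = real k powr (-2)"
      using k by (simp add: powr_minus powr_numeral inverse_eq_divide)
    also have "real k powr (-2) * (C * real k powr (1 / 2)) = C * real k powr (- 3 / 2)"
      by (simp flip: powr_add)
    finally show ?thesis .
  qed
  have "\<forall>k. \<bar>mhs_top p (Suc k)\<bar> \<le> C * real (Suc k) powr (- 3 / 2)"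
    by (intro allI bound) simp
  moreover have "summable (\<lambda>k. C * real (Suc k) powr (- 3 / 2))"
    using summable_Suc_iff[of "\<lambda>k. real k powr (- 3 / 2)"]
    by (intro summable_mult) (simp add: summable_real_powr_iff)
  ultimately show ?thesis by blast
qed

lemma sum_1_eq_lessThan: "(\<Sum>k=1..n. f k) = (\<Sum>k<n. f (Suc k))" for f :: "nat \<Rightarrow> real"
  by (rule sum.reindex_bij_witness[of _ Suc "\<lambda>k. k - 1"]) auto

lemma binom_sum_tendsto_mzv:
  assumes "p \<noteq> []" "\<bar>hd p\<bar> \<ge> 2"
  shows "(\<lambda>n. binom_sum n (mhs_top p)) \<longlonglongrightarrow> mzv p"
proof -
  obtain h where h: "summable h" and le: "\<And>k. \<bar>mhs_top p (Suc k)\<bar> \<le> h k"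
    using mhs_top_dominated[OF assms] by blast
  have "summable (\<lambda>k. mhs_top p (Suc k))"
    using le by (intro summable_comparison_test'[OF h, of 0]) simp
  then have "(\<lambda>n. mhs n p) \<longlonglongrightarrow> (\<Sum>k. mhs_top p (Suc k))"
    unfolding mhs_eq_sum_top[OF assms(1)] sum_1_eq_lessThan by (rule summable_LIMSEQ)
  then have mzv: "mzv p = (\<Sum>k. mhs_top p (Suc k))"
    unfolding mzv_def by (rule limI)
  have "(\<lambda>n. \<Sum>k. binom_ratio n (Suc k) * mhs_top p (Suc k)) \<longlonglongrightarrow> (\<Sum>k. mhs_top p (Suc k))"
  \<comment> \<open>The weights lie in \<open>[0, 1]\<close> and tend to 1, so the majorant of the
    unweighted series serves for all \<open>n\<close>.\<close>
  proof (rule tannerys_theorem[THEN conjunct2, THEN conjunct2])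
    show "(\<lambda>n. binom_ratio n (Suc k) * mhs_top p (Suc k)) \<longlonglongrightarrow> mhs_top p (Suc k)" for k
      using tendsto_mult_right[OF binom_ratio_tendsto[of "Suc k"], of "mhs_top p (Suc k)"] by simp
    show "\<forall>\<^sub>F (k, n) in at_top \<times>\<^sub>F sequentially.
        norm (binom_ratio n (Suc k) * mhs_top p (Suc k)) \<le> h k"
    proof (intro always_eventually, clarify)
      fix k n
      have "\<bar>binom_ratio n (Suc k)\<bar> * \<bar>mhs_top p (Suc k)\<bar> \<le> 1 * h k"
        using binom_ratio_bounds[of n "Suc k"] le[of k] by (intro mult_mono) auto
      then show "norm (binom_ratio n (Suc k) * mhs_top p (Suc k)) \<le> h k"
        by (simp add: abs_mult)
    qed
  qed (use h in auto)
  moreover have "(\<Sum>k. binom_ratio n (Suc k) * mhs_top p (Suc k)) = binom_sum n (mhs_top p)" for n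
    unfolding binom_sum_def sum_1_eq_lessThan
    by (rule suminf_finite) (auto simp: binom_ratio_eq_0)
  ultimately show ?thesis by (simp add: mzv)
qed

lemma mzv_star_dual_index:
  assumes "dual_index s q" "0 \<notin> set q" "q \<noteq> []" "\<bar>hd q\<bar> \<ge> 2"
  shows "mzv_star s = - (\<Sum>p\<in>Pi_indices q. 2 ^ length p * mzv p)"
proof -
  have "(\<lambda>n. - (\<Sum>p\<in>Pi_indices q. 2 ^ length p * binom_sum n (mhs_top p)))
      \<longlonglongrightarrow> - (\<Sum>p\<in>Pi_indices q. 2 ^ length p * mzv p)"
    \<comment> \<open>Merging never shrinks the first entry in absolute value, so the bound on
      \<open>hd q\<close> passes to every \<open>p\<close>.\<close>
    using Pi_indices_hd[OF assms(2,3)] assms(4)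
    by (intro tendsto_minus tendsto_sum tendsto_mult tendsto_const binom_sum_tendsto_mzv)
       (blast, force)
  then have "(\<lambda>n. mhs_star n s) \<longlonglongrightarrow> - (\<Sum>p\<in>Pi_indices q. 2 ^ length p * mzv p)"
    using assms(1) by (simp add: dual_index_def binom_sum_dbl_term[OF assms(2,3)])
  then show ?thesis unfolding mzv_star_def by (rule limI)
qed

section \<open>Both families of indices\<close>

theorem theorem6p2:
  fixes t :: nat and a b :: "nat \<Rightarrow> nat" and c :: "nat \<Rightarrow> int"
  assumes "t \<ge> 1" and "\<forall>j\<ge>1. c j \<ge> 3"
  shows
    "(\<forall>r\<ge>1.
        mzv_star
          (concat (map (\<lambda>j. replicate (b j) 2 @ [c j] @ replicate (a j) 2 @ [1]) [1..<r+1])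
            @ replicate t 2)
        = - (\<Sum>p \<in> Pi_indices
                (concat (map (\<lambda>j. [- (2 * int (b j) + 2)] @ replicate (nat (c j - 3)) 1
                                    @ [- (2 * int (a j) + 2)]) [1..<r+1])
                  @ [- (2 * int t)]).
              2 ^ length p * mzv p))
     \<and> (\<forall>r\<ge>0. a 0 \<ge> 1 \<longrightarrow>
        mzv_star
          (replicate (a 0) 2 @ [1]
            @ concat (map (\<lambda>j. replicate (b j) 2 @ [c j] @ replicate (a j) 2 @ [1]) [1..<r+1])
            @ replicate t 2)
        = - (\<Sum>p \<in> Pi_indices
                ([2 * int (a 0) + 1]
                  @ concat (map (\<lambda>j. [- (2 * int (b j) + 2)] @ replicate (nat (c j - 3)) 1
                                      @ [- (2 * int (a j) + 2)]) [1..<r+1])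
                  @ [- (2 * int t)]).
              2 ^ length p * mzv p))"
proof (intro conjI allI impI)
  fix r :: nat
  let ?js = "[1..<r+1]"
  let ?s = "concat (map (\<lambda>j. replicate (b j) 2 @ [c j] @ replicate (a j) 2 @ [1]) ?js)
      @ replicate t 2"
  let ?q = "concat (map (\<lambda>j. [- (2 * int (b j) + 2)] @ replicate (nat (c j - 3)) 1
      @ [- (2 * int (a j) + 2)]) ?js) @ [- (2 * int t)]"
  have dual: "dual_index ?s ?q"
    using assms by (intro dual_index_blocks) auto
  have nz: "0 \<notin> set ?q" using assms(1) by auto
  \<comment> \<open>For \<open>r = 0\<close> the first entry is \<open>-2t\<close>, otherwise
    \<open>-(2 b_1 + 2)\<close>.\<close>
  have hd: "\<bar>hd ?q\<bar> \<ge> 2"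
    using assms(1) by (cases ?js) auto
  show "mzv_star ?s = - (\<Sum>p \<in> Pi_indices ?q. 2 ^ length p * mzv p)"
    by (rule mzv_star_dual_index[OF dual nz _ hd]) simp
  assume a0: "a 0 \<ge> 1"
  \<comment> \<open>Prepending 1 alone would give the first entry 1; the \<open>a 0 \<ge> 1\<close>
    twos raise it to at least 3, as convergence requires.\<close>
  have "dual_index (replicate (a 0) 2 @ 1 # ?s) ((1 + sgn 1 * (2 * int (a 0))) # ?q)"
    using dual by (intro dual_index_replicate_2 dual_index_Cons_1) auto
  then have "dual_index (replicate (a 0) 2 @ [1] @ ?s) ([2 * int (a 0) + 1] @ ?q)"
    by (simp add: add.commute)
  then show "mzv_star (replicate (a 0) 2 @ [1] @ ?s)
      = - (\<Sum>p \<in> Pi_indices ([2 * int (a 0) + 1] @ ?q). 2 ^ length p * mzv p)"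
    using nz a0 by (intro mzv_star_dual_index) auto
qed

end
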